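(* Let $\{h_r\ (r \text{ simple}),\ e_r\ (r\in E_6)\}$ be a Chevalley basis of the complex simple Lie algebra of type $E_6$, with structure constants $N_{r,s}$ defined by $[e_r,e_s]=N_{r,s}e_{r+s}$, and suppose that the structure constants of all extraspecial pairs are positive (i.e. equal to $1$). Then the structure constants have the following values. (A) Let $0\prec r\prec s$ with $r+s\in E_6$. Then $N_{r,s}=-1$ if $(r,s)$ is one of the following 34 pairs, and $N_{r,s}=1$ otherwise: $r=a+c$ and $s\in\{b+c+2d+e,\ b+c+2d+e+f,\ b+c+2d+2e+f\}$; $r=c+d$ and $s\in\{b+d+e,\ b+d+e+f,\ a+b+c+2d+2e+f\}$; $r=a+c+d$ and $s\in\{b+d+e,\ b+c+d+e,\ b+d+e+f,\ b+c+d+e+f\}$; $r=b+d$ and $s\in\{e,\ e+f,\ a+b+2c+2d+2e+f\}$; $r=b+c+d$ and $s\in\{e,\ d+e,\ e+f,\ d+e+f\}$; $r=a+b+c+d$ and $s\in\{e,\ d+e,\ c+d+e,\ e+f,\ d+e+f,\ c+d+e+f,\ b+c+2d+2e+f\}$; $r=d+e$ and $s\in\{b+c+d+e+f,\ a+b+c+d+e+f\}$; $r=c+d+e$ and $s\in\{a+b+c+d+e+f,\ a+b+c+2d+e+f\}$; $r=b+c+d+e$ and $s\in\{d+e+f,\ a+b+c+2d+e+f\}$; $r=a+b+c+d+e$ and $s\in\{d+e+f,\ c+d+e+f\}$; $r=a+b+c+2d+e$ and $s\in\{c+d+e+f,\ b+c+d+e+f\}$. (B) For all $p,q$ with $0\prec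 p\prec q$ and $p+q\in E_6$, with $N_{p,q}$ given by (A), $$N_{p,-(p+q)}=-N_{p,q},\qquad N_{q,-(p+q)}=N_{p,q}.$$ The remaining non-zero structure constants are obtained from (A) and (B) by $N_{s,r}=-N_{r,s}$ and $N_{-r,-s}=-N_{r,s}$.
   Context: Root system. In $\mathbb{R}^8$ with orthonormal basis $e_1,\dots,e_8$ (these vectors are used only here), the root system $E_6$ consists of the vectors $\pm e_i\pm e_j$ ($1\le i<j\le 5$) and $\pm\frac12\bigl(e_8-e_7-e_6+\sum_{i=1}^5(-1)^{\nu(i)}e_i\bigr)$ with $\nu(i)\in\{0,1\}$ and $\sum_{i=1}^5\nu(i)$ even. The simple roots are $a=\frac12(e_1+e_8-e_2-e_3-e_4-e_5-e_6-e_7)$, $b=e_1+e_2$, $c=e_2-e_1$, $d=e_3-e_2$, $e=e_4-e_3$, $f=e_5-e_4$. (So the Dynkin diagram is the chain $a,c,d,e,f$ with $b$ attached to $d$.) All roots have squared length 2. Order. On the span of the simple roots, $x\prec y$ means that in the expansion $y-x=\tau_1 f+\tau_2 e+\tau_3 b+\tau_4 d+\tau_5 c+\tau_6 a$ the first non-zero coefficient among $\tau_1,\tau_2,\dots,\tau_6$ (in this order) is positive. The roots $r$ with $0\prec r$ are exactly the positive roots. Extraspecial pairs. An ordered pair of roots $(r,s)$ is special if $0\prec r\prec s$ and $r+s\in E_6$. A special pair $(r,s)$ is extraspecial if $r\preceq r_1$ for every special pair $(r_1,s_1)$ with $r_1+s_1=r+s$. Structure constants. $e_r$ ($r\in E_6$)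 are the root vectors of a Chevalley basis: $[e_r,e_{-r}]=h_r$ is the coroot of $r$, and $[e_r,e_s]=N_{r,s}e_{r+s}$ with $N_{r,s}=\pm1$ when $r,s,r+s\in E_6$; $N_{r,s}=0$ when $r+s$ is not a root and $r+s\ne0$. *)

theory Defs
  imports "HOL-Analysis.Analysis"
begin

section \<open>The root system of type E6\<close>

text \<open>In the index type \<open>8\<close> the numeral 8 is 0, so \<open>eb 1, \<dots>, eb 8\<close> are the eight distinct
  standard unit vectors.\<close>

definition eb :: "nat \<Rightarrow> real^8"
  where "eb i = axis (of_nat i) 1"

definition E6 :: "(real^8) set" where
  "E6 = {s *\<^sub>R eb i + t *\<^sub>R eb j | s t i j.
            s \<in> {1, -1} \<and> t \<in> {1, -1} \<and> 1 \<le> i \<and> i < j \<and> j \<le> 5}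
      \<union> {s *\<^sub>R ((1/2) *\<^sub>R (eb 8 - eb 7 - eb 6 + (\<Sum>i=1..5. (-1) ^ \<nu> i *\<^sub>R eb i))) | s \<nu>.
            s \<in> {1, -1} \<and> (\<forall>i\<in>{1..5}. \<nu> i \<in> {0, 1::nat}) \<and> even (\<Sum>i=1..5. \<nu> i)}"

definition ra :: "real^8"
  where "ra = (1/2) *\<^sub>R (eb 1 + eb 8 - eb 2 - eb 3 - eb 4 - eb 5 - eb 6 - eb 7)"
definition rb :: "real^8" where "rb = eb 1 + eb 2"
definition rc :: "real^8" where "rc = eb 2 - eb 1"
definition rd :: "real^8" where "rd = eb 3 - eb 2"
definition re :: "real^8" where "re = eb 4 - eb 3"
definition rf :: "real^8" where "rf = eb 5 - eb 4"

definition simple_roots :: "(real^8) set"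
  where "simple_roots = {ra, rb, rc, rd, re, rf}"

definition prec :: "real^8 \<Rightarrow> real^8 \<Rightarrow> bool"  (infix \<open>\<prec>\<close> 50) where
  "x \<prec> y \<longleftrightarrow> (\<exists>\<tau> :: nat \<Rightarrow> real.
      y - x = \<tau> 1 *\<^sub>R rf + \<tau> 2 *\<^sub>R re + \<tau> 3 *\<^sub>R rb + \<tau> 4 *\<^sub>R rd + \<tau> 5 *\<^sub>R rc + \<tau> 6 *\<^sub>R ra \<and>
      (\<exists>i\<in>{1..6}. 0 < \<tau> i \<and> (\<forall>j\<in>{1..<i}. \<tau> j = 0)))"

definition special :: "real^8 \<Rightarrow> real^8 \<Rightarrow> bool" where
  "special r s \<longleftrightarrow> r \<in> E6 \<and> s \<in> E6 \<and> 0 \<prec> r \<and> r \<prec> s \<and> r + s \<in> E6"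

definition extraspecial :: "real^8 \<Rightarrow> real^8 \<Rightarrow> bool" where
  "extraspecial r s \<longleftrightarrow> special r s \<and>
     (\<forall>r1 s1. special r1 s1 \<and> r1 + s1 = r + s \<longrightarrow> r = r1 \<or> r \<prec> r1)"

definition negative_pairs :: "((real^8) \<times> (real^8)) set" where
  "negative_pairs =
     {ra+rc} \<times> {rb+rc+2*\<^sub>Rrd+re, rb+rc+2*\<^sub>Rrd+re+rf, rb+rc+2*\<^sub>Rrd+2*\<^sub>Rre+rf}
   \<union> {rc+rd} \<times> {rb+rd+re, rb+rd+re+rf, ra+rb+rc+2*\<^sub>Rrd+2*\<^sub>Rre+rf}
   \<union> {ra+rc+rd} \<times> {rb+rd+re, rb+rc+rd+re, rb+rd+re+rf, rb+rc+rd+re+rf}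
   \<union> {rb+rd} \<times> {re, re+rf, ra+rb+2*\<^sub>Rrc+2*\<^sub>Rrd+2*\<^sub>Rre+rf}
   \<union> {rb+rc+rd} \<times> {re, rd+re, re+rf, rd+re+rf}
   \<union> {ra+rb+rc+rd} \<times> {re, rd+re, rc+rd+re, re+rf, rd+re+rf, rc+rd+re+rf,
                       rb+rc+2*\<^sub>Rrd+2*\<^sub>Rre+rf}
   \<union> {rd+re} \<times> {rb+rc+rd+re+rf, ra+rb+rc+rd+re+rf}
   \<union> {rc+rd+re} \<times> {ra+rb+rc+rd+re+rf, ra+rb+rc+2*\<^sub>Rrd+re+rf}
   \<union> {rb+rc+rd+re} \<times> {rd+re+rf, ra+rb+rc+2*\<^sub>Rrd+re+rf}
   \<union> {ra+rb+rc+rd+re} \<times> {rd+re+rf, rc+rd+re+rf}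
   \<union> {ra+rb+rc+2*\<^sub>Rrd+re} \<times> {rc+rd+re+rf, rb+rc+rd+re+rf}"

text \<open>The pairs reached from the special pairs \<open>(p, q)\<close> and the pairs \<open>(p, -(p+q))\<close>,
  \<open>(q, -(p+q))\<close> by exchanging the two roots and by negating both of them.\<close>

inductive_set obtained_pairs :: "((real^8) \<times> (real^8)) set" where
  special: "special p q \<Longrightarrow> (p, q) \<in> obtained_pairs"
| minus_fst: "special p q \<Longrightarrow> (p, - (p + q)) \<in> obtained_pairs"
| minus_snd: "special p q \<Longrightarrow> (q, - (p + q)) \<in> obtained_pairs"
| swap: "(r, s) \<in> obtained_pairs \<Longrightarrow> (s, r) \<in> obtained_pairs"
| neg: "(r, s) \<in> obtained_pairs \<Longrightarrow> (- r, - s) \<in> obtained_pairs"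

section \<open>Complex Lie algebras, Cartan subalgebras and roots\<close>

locale lie_algebra = vector_space scale
  for scale :: "complex \<Rightarrow> 'g::ab_group_add \<Rightarrow> 'g"  (infixr \<open>*C\<close> 75) +
  fixes bracket :: "'g \<Rightarrow> 'g \<Rightarrow> 'g"  (\<open>\<lbrakk>_, _\<rbrakk>\<close>)
  assumes bracket_add_left: "\<lbrakk>x + y, z\<rbrakk> = \<lbrakk>x, z\<rbrakk> + \<lbrakk>y, z\<rbrakk>"
    and bracket_add_right: "\<lbrakk>x, y + z\<rbrakk> = \<lbrakk>x, y\<rbrakk> + \<lbrakk>x, z\<rbrakk>"
    and bracket_scale_left: "\<lbrakk>c *C x, y\<rbrakk> = c *C \<lbrakk>x, y\<rbrakk>"
    and bracket_scale_right: "\<lbrakk>x, c *C y\<rbrakk> = c *C \<lbrakk>x, y\<rbrakk>"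
    and bracket_self: "\<lbrakk>x, x\<rbrakk> = 0"
    and jacobi: "\<lbrakk>x, \<lbrakk>y, z\<rbrakk>\<rbrakk> + \<lbrakk>y, \<lbrakk>z, x\<rbrakk>\<rbrakk> + \<lbrakk>z, \<lbrakk>x, y\<rbrakk>\<rbrakk> = 0"
begin

definition bracket_span :: "'g set \<Rightarrow> 'g set \<Rightarrow> 'g set"
  where "bracket_span A B = span {\<lbrakk>x, y\<rbrakk> | x y. x \<in> A \<and> y \<in> B}"

definition subalgebra :: "'g set \<Rightarrow> bool"
  where "subalgebra H \<longleftrightarrow> subspace H \<and> (\<forall>x\<in>H. \<forall>y\<in>H. \<lbrakk>x, y\<rbrakk> \<in> H)"

definition ideal :: "'g set \<Rightarrow> bool"
  where "ideal I \<longleftrightarrow> subspace I \<and> (\<forall>x. \<forall>y\<in>I. \<lbrakk>x, y\<rbrakk> \<in> I)"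

fun lower_central :: "'g set \<Rightarrow> nat \<Rightarrow> 'g set" where
  "lower_central H 0 = H"
| "lower_central H (Suc n) = bracket_span H (lower_central H n)"

definition nilpotent :: "'g set \<Rightarrow> bool"
  where "nilpotent H \<longleftrightarrow> (\<exists>n. lower_central H n = {0})"

definition normalizer :: "'g set \<Rightarrow> 'g set"
  where "normalizer H = {x. \<forall>y\<in>H. \<lbrakk>x, y\<rbrakk> \<in> H}"

definition cartan_subalgebra :: "'g set \<Rightarrow> bool"
  where "cartan_subalgebra H \<longleftrightarrow> subalgebra H \<and> nilpotent H \<and> normalizer H = H"

definition root_space :: "'g set \<Rightarrow> ('g \<Rightarrow> complex) \<Rightarrow> 'g set"
  where "root_space H \<alpha> = {x. \<forall>y\<in>H. \<lbrakk>y, x\<rbrakk> = \<alpha> y *C x}"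

definition linear_form_on :: "'g set \<Rightarrow> ('g \<Rightarrow> complex) \<Rightarrow> bool"
  where "linear_form_on H \<alpha> \<longleftrightarrow>
    (\<forall>x\<in>H. \<forall>y\<in>H. \<alpha> (x + y) = \<alpha> x + \<alpha> y) \<and> (\<forall>c. \<forall>x\<in>H. \<alpha> (c *C x) = c * \<alpha> x)"

text \<open>Linear forms on \<open>H\<close> are made unique as HOL functions by \<^const>\<open>extensional\<close>.\<close>

definition roots :: "'g set \<Rightarrow> ('g \<Rightarrow> complex) set"
  where "roots H = {\<alpha> \<in> extensional H. linear_form_on H \<alpha> \<and> (\<exists>y\<in>H. \<alpha> y \<noteq> 0) \<and>
                       root_space H \<alpha> \<noteq> {0}}"

definition is_coroot :: "'g set \<Rightarrow> ('g \<Rightarrow> complex) \<Rightarrow> 'g \<Rightarrow> bool"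
  where "is_coroot H \<alpha> t \<longleftrightarrow>
    t \<in> H \<and> t \<in> bracket_span (root_space H \<alpha>) (root_space H (\<lambda>y. - \<alpha> y)) \<and> \<alpha> t = 2"

text \<open>An isomorphism of root systems from \<^const>\<open>E6\<close> onto the roots of \<open>H\<close>: an injective real-linear
  map on the span of \<^const>\<open>E6\<close> that carries roots onto roots and preserves Cartan integers.
  The last conjunct compares \<open>2 (s, r) / (r, r)\<close> with the value of the root \<open>\<phi> s\<close> at the coroot
  of \<open>\<phi> r\<close>.\<close>

definition E6_root_iso :: "'g set \<Rightarrow> (real^8 \<Rightarrow> 'g \<Rightarrow> complex) \<Rightarrow> bool"
  where "E6_root_iso H \<phi> \<longleftrightarrow>
    (\<forall>x\<in>Real_Vector_Spaces.span E6. \<forall>y\<in>Real_Vector_Spaces.span E6. \<forall>t\<in>H.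
        \<phi> (x + y) t = \<phi> x t + \<phi> y t) \<and>
    (\<forall>c. \<forall>x\<in>Real_Vector_Spaces.span E6. \<forall>t\<in>H. \<phi> (c *\<^sub>R x) t = of_real c * \<phi> x t) \<and>
    (\<forall>x\<in>Real_Vector_Spaces.span E6. (\<forall>t\<in>H. \<phi> x t = 0) \<longrightarrow> x = 0) \<and>
    bij_betw \<phi> E6 (roots H) \<and>
    (\<forall>r\<in>E6. \<forall>s\<in>E6. \<forall>t. is_coroot H (\<phi> r) t \<longrightarrow>
        \<phi> s t = of_real (2 * (s \<bullet> r) / (r \<bullet> r)))"

end

locale simple_lie_algebra = lie_algebra scale bracket
  for scale :: "complex \<Rightarrow> 'g::ab_group_add \<Rightarrow> 'g"  (infixr \<open>*C\<close> 75)
    and bracket :: "'g \<Rightarrow> 'g \<Rightarrow> 'g"  (\<open>\<lbrakk>_, _\<rbrakk>\<close>) +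
  assumes finite_dim: "\<exists>B. finite B \<and> span B = UNIV"
    and nonabelian: "\<exists>x y. \<lbrakk>x, y\<rbrakk> \<noteq> 0"
    and ideals_trivial: "ideal I \<Longrightarrow> I = {0} \<or> I = UNIV"

section \<open>Chevalley bases of type E6\<close>

text \<open>The map \<open>\<phi>\<close> names the roots with respect to the Cartan subalgebra \<open>H\<close> by the vectors of
  \<^const>\<open>E6\<close>. The values \<open>N r (- r)\<close> are left unspecified, since \<open>\<lbrakk>e r, e (- r)\<rbrakk>\<close> is not a multiple of
  a root vector.\<close>

locale E6_chevalley_basis = simple_lie_algebra scale bracket
  for scale :: "complex \<Rightarrow> 'g::ab_group_add \<Rightarrow> 'g"  (infixr \<open>*C\<close> 75)
    and bracket :: "'g \<Rightarrow> 'g \<Rightarrow> 'g"  (\<open>\<lbrakk>_, _\<rbrakk>\<close>) +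
  fixes H :: "'g set"
    and \<phi> :: "real^8 \<Rightarrow> 'g \<Rightarrow> complex"
    and h e :: "real^8 \<Rightarrow> 'g"
    and N :: "real^8 \<Rightarrow> real^8 \<Rightarrow> complex"
  assumes cartan: "cartan_subalgebra H"
    and type_E6: "E6_root_iso H \<phi>"
    and basis: "independent (h ` simple_roots \<union> e ` E6)" "span (h ` simple_roots \<union> e ` E6) = UNIV"
    and root_vector: "r \<in> E6 \<Longrightarrow> e r \<in> root_space H (\<phi> r)"
    and coroot: "r \<in> E6 \<Longrightarrow> is_coroot H (\<phi> r) (h r)"
    and bracket_opposite: "r \<in> E6 \<Longrightarrow> \<lbrakk>e r, e (- r)\<rbrakk> = h r"
    and bracket_roots: "r \<in> E6 \<Longrightarrow> s \<in> E6 \<Longrightarrow> r + s \<noteq> 0 \<Longrightarrow> \<lbrakk>e r, e s\<rbrakk> = N r s *C e (r + s)"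
    and N_root: "r \<in> E6 \<Longrightarrow> s \<in> E6 \<Longrightarrow> r + s \<in> E6 \<Longrightarrow> N r s \<in> {1, -1}"
    and N_nonroot: "r \<in> E6 \<Longrightarrow> s \<in> E6 \<Longrightarrow> r + s \<notin> E6 \<Longrightarrow> r + s \<noteq> 0 \<Longrightarrow> N r s = 0"

end

theory Submission
  imports Defs
begin

text \<open>
  If \<open>r, s, t, r + s, s + t, r + s + t\<close> are roots of a simply laced system, then \<open>r + t\<close> is neither a
  root nor \<open>0\<close>, and the Jacobi identity reads
  \<open>N r s * N (r + s) t = N s t * N r (s + t)\<close>. Let \<open>(z, g - z)\<close> be the extraspecial pair with sum
  \<open>g = x + y\<close>, where \<open>(x, y)\<close> is special and \<open>x \<noteq> z\<close>. Since \<open>g\<close> and \<open>z\<close> have inner product 1, exactly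
  one of \<open>x - z\<close> and \<open>y - z\<close> is a positive root, and the identity expresses \<open>N x y\<close> by two constants
  of pairs with smaller sums. By induction on the height it remains to check that the asserted signs
  satisfy this recursion, which is a finite computation in integer coordinates.

  The relations for the other pairs come from the Jacobi identity for roots with \<open>r + s + t = 0\<close>,
  bracketed with \<open>e r\<close>, and for \<open>r, s, - r\<close>.
\<close>

section \<open>Integer coordinates\<close>

text \<open>Coordinates are taken with respect to \<open>f, e, b, d, c, a\<close> in this order, so that \<open>\<prec>\<close> is the
  lexicographic order.\<close>

type_synonym coords = "int \<times> int \<times> int \<times> int \<times> int \<times> int"

fun comb :: "coords \<Rightarrow> real^8" where
  "comb (x1, x2, x3, x4, x5, x6) =
     of_int x1 *\<^sub>R rf + of_int x2 *\<^sub>R re + of_int x3 *\<^sub>R rb + of_int x4 *\<^sub>R rd +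
     of_int x5 *\<^sub>R rc + of_int x6 *\<^sub>R ra"

definition posroots :: "coords list" where
  "posroots =
    [(0,0,0,0,0,1), (0,0,0,0,1,0), (0,0,0,0,1,1), (0,0,0,1,0,0), (0,0,0,1,1,0), (0,0,0,1,1,1),
     (0,0,1,0,0,0), (0,0,1,1,0,0), (0,0,1,1,1,0), (0,0,1,1,1,1), (0,1,0,0,0,0), (0,1,0,1,0,0),
     (0,1,0,1,1,0), (0,1,0,1,1,1), (0,1,1,1,0,0), (0,1,1,1,1,0), (0,1,1,1,1,1), (0,1,1,2,1,0),
     (0,1,1,2,1,1), (0,1,1,2,2,1), (1,0,0,0,0,0), (1,1,0,0,0,0), (1,1,0,1,0,0), (1,1,0,1,1,0),
     (1,1,0,1,1,1), (1,1,1,1,0,0), (1,1,1,1,1,0), (1,1,1,1,1,1), (1,1,1,2,1,0), (1,1,1,2,1,1),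
     (1,1,1,2,2,1), (1,2,1,2,1,0), (1,2,1,2,1,1), (1,2,1,2,2,1), (1,2,1,3,2,1), (1,2,2,3,2,1)]"

text \<open>The blocks of \<^const>\<open>negative_pairs\<close> are listed in reverse, since this is the order in which
  simplification enumerates the union of products.\<close>

definition neg_pairs :: "(coords \<times> coords) list" where
  "neg_pairs = concat (map (\<lambda>(r, ss). map (Pair r) ss)
    [((0,1,1,2,1,1), [(1,1,0,1,1,0), (1,1,1,1,1,0)]),
     ((0,1,1,1,1,1), [(1,1,0,1,0,0), (1,1,0,1,1,0)]),
     ((0,1,1,1,1,0), [(1,1,0,1,0,0), (1,1,1,2,1,1)]),
     ((0,1,0,1,1,0), [(1,1,1,1,1,1), (1,1,1,2,1,1)]),
     ((0,1,0,1,0,0), [(1,1,1,1,1,0), (1,1,1,1,1,1)]),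
     ((0,0,1,1,1,1), [(0,1,0,0,0,0), (0,1,0,1,0,0), (0,1,0,1,1,0), (1,1,0,0,0,0),
                      (1,1,0,1,0,0), (1,1,0,1,1,0), (1,2,1,2,1,0)]),
     ((0,0,1,1,1,0), [(0,1,0,0,0,0), (0,1,0,1,0,0), (1,1,0,0,0,0), (1,1,0,1,0,0)]),
     ((0,0,1,1,0,0), [(0,1,0,0,0,0), (1,1,0,0,0,0), (1,2,1,2,2,1)]),
     ((0,0,0,1,1,1), [(0,1,1,1,0,0), (0,1,1,1,1,0), (1,1,1,1,0,0), (1,1,1,1,1,0)]),
     ((0,0,0,1,1,0), [(0,1,1,1,0,0), (1,1,1,1,0,0), (1,2,1,2,1,1)]),
     ((0,0,0,0,1,1), [(0,1,1,2,1,0), (1,1,1,2,1,0), (1,2,1,2,1,0)])])"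

fun lexpos :: "coords \<Rightarrow> bool" where
  "lexpos (x1, x2, x3, x4, x5, x6) \<longleftrightarrow>
     x1 > 0 \<or> x1 = 0 \<and> (x2 > 0 \<or> x2 = 0 \<and> (x3 > 0 \<or> x3 = 0 \<and> (x4 > 0 \<or> x4 = 0 \<and>
     (x5 > 0 \<or> x5 = 0 \<and> x6 > 0))))"

text \<open>The table lists ordered pairs only. It is extended antisymmetrically because the
  recursion also asks for pairs whose larger root comes first. The value has no meaning when
  \<open>x + y\<close> is not a root.\<close>

definition sgn_coords :: "coords \<Rightarrow> coords \<Rightarrow> int" where
  "sgn_coords x y =
     (if lexpos (y - x) then if (x, y) \<in> set neg_pairs then -1 else 1
      else if (y, x) \<in> set neg_pairs then 1 else -1)"

text \<open>Coordinates with respect to the vectors \<open>eb i\<close> are doubled to make them integral.\<close>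

definition doubled :: "int list \<Rightarrow> real^8" where
  "doubled xs = (1/2) *\<^sub>R (\<Sum>k<8. of_int (xs ! k) *\<^sub>R eb (Suc k))"

fun eb_coords :: "coords \<Rightarrow> int list" where
  "eb_coords (x1, x2, x3, x4, x5, x6) =
     [x6 + 2 * x3 - 2 * x5, 2 * x3 + 2 * x5 - 2 * x4 - x6, 2 * x4 - 2 * x2 - x6,
      2 * x2 - 2 * x1 - x6, 2 * x1 - x6, - x6, - x6, x6]"

definition integral_roots :: "int list list" where
  "integral_roots = [map (\<lambda>k. if k = i then 2 * s else if k = j then 2 * t else 0) [1..<9].
     s \<leftarrow> [1, -1], t \<leftarrow> [1, -1], i \<leftarrow> [1..<6], j \<leftarrow> [Suc i..<6]]"

text \<open>A product of signs is 1 exactly when the number of minus signs is even, so the filter on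
  the product encodes the parity condition on the exponents.\<close>

definition spinor_roots :: "int list list" where
  "spinor_roots = [[s * x1, s * x2, s * x3, s * x4, s * x5, - s, - s, s].
     s \<leftarrow> [1, -1], x1 \<leftarrow> [1, -1], x2 \<leftarrow> [1, -1], x3 \<leftarrow> [1, -1], x4 \<leftarrow> [1, -1], x5 \<leftarrow> [1, -1],
     x1 * x2 * x3 * x4 * x5 = 1]"

text \<open>The list \<^const>\<open>posroots\<close> is increasing, so this is the first component of the extraspecial
  pair with sum \<open>g\<close>.\<close>

definition first_summand :: "coords \<Rightarrow> coords option" where
  "first_summand g = find (\<lambda>z. g - z \<in> set posroots) posroots"

text \<open>The recursion satisfied by the structure constants. Conditionals replace conjunctions because
  \<open>code_simp\<close> evaluates both arguments of a conjunction.\<close>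

definition check_pair :: "coords \<Rightarrow> coords \<Rightarrow> bool" where
  "check_pair x y =
     (if lexpos (y - x) then if x + y \<in> set posroots then
       (case first_summand (x + y) of
          None \<Rightarrow> False
        | Some z \<Rightarrow>
            if x = z then sgn_coords x y = 1
            else if x - z \<in> set posroots
            then sgn_coords x y = sgn_coords (x - z) y * sgn_coords z (x - z)
            else if y - z \<in> set posroots
            then sgn_coords x y = - sgn_coords (y - z) x * sgn_coords z (y - z)
            else False)
      else True else True)"

section \<open>Finite checks by evaluation\<close>

lemma sorted_posroots: "sorted_wrt (\<lambda>x y. lexpos (y - x)) posroots"
  by code_simp

lemma eb_coords_posroots:
  "list_all (\<lambda>x. eb_coords x \<in> set (integral_roots @ spinor_roots))
     (posroots @ map uminus posroots)"
  by code_simp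

lemma eb_coords_surj:
  "list_all (\<lambda>v. v \<in> set (map eb_coords (posroots @ map uminus posroots)))
     (integral_roots @ spinor_roots)"
  by code_simp

text \<open>Doubling the coordinates multiplies squared lengths by 4, so 8 stands for the squared
  length 2.\<close>

lemma eb_coords_norm:
  "list_all (\<lambda>v. (\<Sum>k\<leftarrow>[0..<8]. (v ! k)\<^sup>2) = 8) (integral_roots @ spinor_roots)"
  by code_simp

lemma lexpos_posroots: "list_all lexpos posroots"
  by code_simp

fun height :: "coords \<Rightarrow> int" where
  "height (x1, x2, x3, x4, x5, x6) = x1 + x2 + x3 + x4 + x5 + x6"

lemma height_posroots: "list_all (\<lambda>x. 0 < height x) posroots"
  by code_simp

lemma distinct_neg_pairs: "distinct neg_pairs" "length neg_pairs = 34"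
  by code_simp+

text \<open>Since the branch \<open>None\<close> and the innermost \<open>else\<close> return
  \<open>False\<close>, this evaluation also shows that every special pair has a first summand
  \<open>z\<close> and, if \<open>x\<close> differs from \<open>z\<close>, that \<open>x - z\<close>
  or \<open>y - z\<close> is a positive root.\<close>

lemma check_pairs: "list_all (\<lambda>x. list_all (check_pair x) posroots) posroots"
  by code_simp

section \<open>The root system in coordinates\<close>

text \<open>The index type is arithmetic modulo 8, so the bounds are what keeps the unit vectors
  distinct.\<close>

lemma eb_inner:
  assumes "i < 8" "j < 8"
  shows "eb (Suc i) \<bullet> eb (Suc j) = (if i = j then 1 else 0)"
proof -
  have *: "i \<in> {0,1,2,3,4,5,6,7}" "j \<in> {0,1,2,3,4,5,6,7}" using assms by auto
  show ?thesis using *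
    by (elim insertE) (simp_all add: eb_def inner_axis_axis)
qed

text \<open>The entries of \<open>eb_coords\<close> are twice the coefficients obtained by expanding
  the simple roots in the unit vectors.\<close>

lemma comb_doubled: "comb x = doubled (eb_coords x)"
proof -
  obtain x1 x2 x3 x4 x5 x6 where x: "x = (x1, x2, x3, x4, x5, x6)" by (cases x) auto
  then show ?thesis
    by (simp add: doubled_def ra_def rb_def rc_def rd_def re_def rf_def
        lessThan_nat_numeral scaleR_add_right scaleR_diff_right scaleR_add_left scaleR_diff_left
        diff_divide_distrib add_divide_distrib flip: numeral_2_eq_2)
qed

lemma simple_independent:
  assumes "t1 *\<^sub>R rf + t2 *\<^sub>R re + t3 *\<^sub>R rb + t4 *\<^sub>R rd + t5 *\<^sub>R rc + t6 *\<^sub>R ra = 0"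
  shows "t1 = 0 \<and> t2 = 0 \<and> t3 = 0 \<and> t4 = 0 \<and> t5 = 0 \<and> t6 = 0"
proof -
  let ?v = "t1 *\<^sub>R rf + t2 *\<^sub>R re + t3 *\<^sub>R rb + t4 *\<^sub>R rd + t5 *\<^sub>R rc + t6 *\<^sub>R ra"
  \<comment> \<open>Pairing with the eight unit vectors turns the relation into a linear system that
    determines all six coefficients.\<close>
  have "?v \<bullet> eb (Suc i) = 0" for i using assms by simp
  from this[of 0] this[of 1] this[of 2] this[of 3] this[of 4] this[of 5] this[of 6] this[of 7]
  show ?thesis
    by (simp add: ra_def rb_def rc_def rd_def re_def rf_def inner_add_left inner_diff_left
        eb_def inner_axis_axis)
qed

lemma comb_add: "comb (x + y) = comb x + comb y"
  by (cases x; cases y) (simp add: algebra_simps)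

lemma comb_minus: "comb (- x) = - comb x"
  by (cases x) simp

lemma comb_diff: "comb (x - y) = comb x - comb y"
  by (cases x; cases y) (simp add: algebra_simps)

lemma comb_eq_0: "comb x = 0 \<longleftrightarrow> x = 0"
  by (cases x) (auto simp: zero_prod_def dest: simple_independent)

lemma inj_comb: "inj comb"
proof (rule injI)
  fix x y assume "comb x = comb y"
  then have "comb (x - y) = 0" by (simp add: comb_diff)
  then show "x = y" by (simp add: comb_eq_0)
qed

section \<open>The order in coordinates\<close>

lemma first_nonzero_pos:
  fixes \<tau> :: "nat \<Rightarrow> real"
  shows "(\<exists>i\<in>{1..6}. 0 < \<tau> i \<and> (\<forall>j\<in>{1..<i}. \<tau> j = 0)) \<longleftrightarrow>
    0 < \<tau> 1 \<or> \<tau> 1 = 0 \<and> (0 < \<tau> 2 \<or> \<tau> 2 = 0 \<and> (0 < \<tau> 3 \<or> \<tau> 3 = 0 \<and> (0 < \<tau> 4 \<or> \<tau> 4 = 0 \<and>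
    (0 < \<tau> 5 \<or> \<tau> 5 = 0 \<and> 0 < \<tau> 6))))"
proof -
  have I: "{1..6} = {1, 2, 3, 4, 5, 6::nat}" by auto
  have J: "{1..<1} = ({} :: nat set)" "{1..<2} = {1::nat}" "{1..<3} = {1, 2::nat}"
    "{1..<4} = {1, 2, 3::nat}" "{1..<5} = {1, 2, 3, 4::nat}" "{1..<6} = {1, 2, 3, 4, 5::nat}" by auto
  show ?thesis
    unfolding I ball_simps bex_simps J by blast
qed

lemma zero_prec_comb: "0 \<prec> comb x \<longleftrightarrow> lexpos x"
proof -
  obtain x1 x2 x3 x4 x5 x6 where x: "x = (x1, x2, x3, x4, x5, x6)" by (cases x) auto
  \<comment> \<open>The leading 0 is a dummy entry: the coefficients are numbered from 1. This
    function witnesses that an expansion exists; independence of the simple roots makes its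
    coefficients unique.\<close>
  let ?t = "\<lambda>i::nat. of_int ([0, x1, x2, x3, x4, x5, x6] ! i) :: real"
  have "comb x = \<tau> 1 *\<^sub>R rf + \<tau> 2 *\<^sub>R re + \<tau> 3 *\<^sub>R rb + \<tau> 4 *\<^sub>R rd + \<tau> 5 *\<^sub>R rc + \<tau> 6 *\<^sub>R ra \<longleftrightarrow>
    \<tau> 1 = x1 \<and> \<tau> 2 = x2 \<and> \<tau> 3 = x3 \<and> \<tau> 4 = x4 \<and> \<tau> 5 = x5 \<and> \<tau> 6 = x6" (is "?l \<tau> = ?r \<tau>")
    for \<tau> :: "nat \<Rightarrow> real"
  proof
    assume "?l \<tau>"
    then have "(\<tau> 1 - x1) *\<^sub>R rf + (\<tau> 2 - x2) *\<^sub>R re + (\<tau> 3 - x3) *\<^sub>R rb + (\<tau> 4 - x4) *\<^sub>R rd +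
       (\<tau> 5 - x5) *\<^sub>R rc + (\<tau> 6 - x6) *\<^sub>R ra = 0"
      by (simp add: x algebra_simps)
    from simple_independent[OF this] show "?r \<tau>" by simp
  qed (simp add: x)
  then have "0 \<prec> comb x \<longleftrightarrow> (\<exists>\<tau>. ?r \<tau> \<and> lexpos x)"
    unfolding prec_def first_nonzero_pos diff_zero by (simp add: x cong: conj_cong)
  moreover have "\<exists>\<tau>. ?r \<tau>"
    by (rule exI[of _ ?t]) (simp add: numeral_eq_Suc)
  ultimately show ?thesis
    by (simp only: ex_simps simp_thms)
qed

lemma prec_comb: "comb x \<prec> comb y \<longleftrightarrow> lexpos (y - x)"
  using zero_prec_comb[of "y - x"] by (simp add: prec_def comb_diff)

lemma lexpos_add: "lexpos x \<Longrightarrow> lexpos y \<Longrightarrow> lexpos (x + y)"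
  by (cases x; cases y) auto

lemma lexpos_cases: "x = 0 \<or> lexpos x \<or> lexpos (- x)"
  by (cases x) (auto simp: zero_prod_def)

lemma lexpos_0: "\<not> lexpos 0" by (simp add: zero_prod_def)

section \<open>Enumeration of the roots\<close>

lemma doubled_integral:
  assumes "1 \<le> i" "i < j" "j < 9"
  shows "doubled (map (\<lambda>k. if k = i then 2 * s else if k = j then 2 * t else 0) [1..<9]) =
    of_int s *\<^sub>R eb i + of_int t *\<^sub>R eb j"
proof -
  \<comment> \<open>List positions start at 0, the unit vectors at 1.\<close>
  obtain i' j' where ij: "i = Suc i'" "j = Suc j'" "i' < j'" "j' < 8"
    using assms by (cases i; cases j) auto
  have "doubled (map (\<lambda>k. if k = i then 2 * s else if k = j then 2 * t else 0) [1..<9]) =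
     (1/2) *\<^sub>R (\<Sum>k<8. (if k = i' then (2 * of_int s) *\<^sub>R eb (Suc k) else 0) +
       (if k = j' then (2 * of_int t) *\<^sub>R eb (Suc k) else 0))"
    unfolding doubled_def using ij by (intro arg_cong2[where f = scaleR] sum.cong) auto
  then show ?thesis
    using ij by (simp add: sum.distrib scaleR_add_right)
qed

lemma doubled_spinor:
  "doubled [s * x 1, s * x 2, s * x 3, s * x 4, s * x 5, - s, - s, s] =
     of_int s *\<^sub>R ((1/2) *\<^sub>R (eb 8 - eb 7 - eb 6 + (\<Sum>i=1..5. of_int (x i) *\<^sub>R eb i)))"
proof -
  have "{1..5} = {1, 2, 3, 4, 5::nat}" by auto
  then show ?thesis
    by (simp add: doubled_def lessThan_nat_numeral algebra_simps flip: numeral_2_eq_2)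
qed

lemma E6_doubled: "E6 = doubled ` set (integral_roots @ spinor_roots)"
proof -
  have "{s *\<^sub>R eb i + t *\<^sub>R eb j | s t i j.
      s \<in> {1, -1} \<and> t \<in> {1, -1} \<and> 1 \<le> i \<and> i < j \<and> j \<le> 5} = doubled ` set integral_roots" (is "?D = _")
  proof -
    define M :: "int \<Rightarrow> int \<Rightarrow> nat \<Rightarrow> nat \<Rightarrow> int list" where
      "M s t i j = map (\<lambda>k. if k = i then 2 * s else if k = j then 2 * t else 0) [1..<9]" for s t i j
    have M: "doubled (M s t i j) = of_int s *\<^sub>R eb i + of_int t *\<^sub>R eb j"
      if "1 \<le> i" "i < j" "j \<le> 5" for s t i j
      using doubled_integral[of i j s t] that by (simp add: M_def)
    have set: "v \<in> set integral_roots \<longleftrightarrow> (\<exists>s t i j. v = M s t i j \<and>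
        s \<in> {1, -1} \<and> t \<in> {1, -1} \<and> 1 \<le> i \<and> i < j \<and> j \<le> 5)" for v
      unfolding integral_roots_def M_def[symmetric] by fastforce
    show ?thesis
    proof (intro equalityI subsetI)
      fix v assume "v \<in> ?D"
      then obtain s t :: real and i j where v: "v = s *\<^sub>R eb i + t *\<^sub>R eb j" and
        st: "s \<in> {1, -1}" "t \<in> {1, -1}" and ij: "1 \<le> i" "i < j" "j \<le> 5" by blast
      from st obtain s' t' :: int where "s = of_int s'" "t = of_int t'" "s' \<in> {1, -1}" "t' \<in> {1, -1}"
        by (metis insertE insertI1 insertI2 of_int_1 of_int_minus singletonD)
      with v M[OF ij, of s' t'] ij show "v \<in> doubled ` set integral_roots"
        by (intro image_eqI[of _ _ "M s' t' i j"]) (auto simp: set)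
    next
      fix v assume "v \<in> doubled ` set integral_roots"
      then obtain s t i j where "v = doubled (M s t i j)" "s \<in> {1, -1}" "t \<in> {1, -1}"
        and ij: "1 \<le> i" "i < j" "j \<le> 5" by (auto simp: set)
      with M[OF ij] show "v \<in> ?D"
        by (intro CollectI exI[of _ "of_int s"] exI[of _ "of_int t"] exI[of _ i] exI[of _ j]) auto
    qed
  qed
  moreover have "{s *\<^sub>R ((1/2) *\<^sub>R (eb 8 - eb 7 - eb 6 + (\<Sum>i=1..5. (-1) ^ \<nu> i *\<^sub>R eb i))) | s \<nu>.
      s \<in> {1, -1} \<and> (\<forall>i\<in>{1..5}. \<nu> i \<in> {0, 1::nat}) \<and> even (\<Sum>i=1..5. \<nu> i)} =
    doubled ` set spinor_roots" (is "?S = _")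
  proof -
    have I: "{1..5} = {1, 2, 3, 4, 5::nat}" by auto
    have set: "v \<in> set spinor_roots \<longleftrightarrow> (\<exists>s (x :: nat \<Rightarrow> int).
        v = [s * x 1, s * x 2, s * x 3, s * x 4, s * x 5, - s, - s, s] \<and>
        s \<in> {1, -1} \<and> (\<forall>i\<in>{1..5}. x i \<in> {1, -1}) \<and> (\<Prod>i=1..5. x i) = 1)" for v
    proof
      \<comment> \<open>The abbreviation keeps \<open>auto\<close> from splitting into all combinations of signs.\<close>
      define L where "L = [1, -1 :: int]"
      assume "v \<in> set spinor_roots"
      then have "\<exists>s x1 x2 x3 x4 x5. v = [s * x1, s * x2, s * x3, s * x4, s * x5, - s, - s, s] \<and>
        s \<in> set L \<and> {x1, x2, x3, x4, x5} \<subseteq> set L \<and> x1 * x2 * x3 * x4 * x5 = 1"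
        unfolding spinor_roots_def L_def[symmetric] by auto blast
      then obtain s x1 x2 x3 x4 x5 where
        "v = [s * x1, s * x2, s * x3, s * x4, s * x5, - s, - s, s]"
        "s \<in> set L" "{x1, x2, x3, x4, x5} \<subseteq> set L" "x1 * x2 * x3 * x4 * x5 = 1"
        by blast
      moreover have "set L = {1, -1}" unfolding L_def by simp
      ultimately show "\<exists>s (x :: nat \<Rightarrow> int).
        v = [s * x 1, s * x 2, s * x 3, s * x 4, s * x 5, - s, - s, s] \<and>
        s \<in> {1, -1} \<and> (\<forall>i\<in>{1..5}. x i \<in> {1, -1}) \<and> (\<Prod>i=1..5. x i) = 1"
        unfolding I by (intro exI[of _ s] exI[of _ "\<lambda>i. [0, x1, x2, x3, x4, x5] ! i"])
          (simp add: numeral_eq_Suc mult.assoc)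
    next
      assume "\<exists>s (x :: nat \<Rightarrow> int).
        v = [s * x 1, s * x 2, s * x 3, s * x 4, s * x 5, - s, - s, s] \<and>
        s \<in> {1, -1} \<and> (\<forall>i\<in>{1..5}. x i \<in> {1, -1}) \<and> (\<Prod>i=1..5. x i) = (1::int)"
      then obtain s and x :: "nat \<Rightarrow> int"
        where v: "v = [s * x 1, s * x 2, s * x 3, s * x 4, s * x 5, - s, - s, s]"
        and s: "s \<in> {1, -1}" and x: "\<forall>i\<in>{1..5}. x i \<in> {1, -1}" "(\<Prod>i=1..5. x i) = (1::int)"
        by blast
      from x have x': "x 1 \<in> {1, -1}" "x 2 \<in> {1, -1}" "x 3 \<in> {1, -1}" "x 4 \<in> {1, -1}" "x 5 \<in> {1, -1}"
        by (auto simp: I)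
      from x(2) have "x 1 * x 2 * x 3 * x 4 * x 5 = 1"
        unfolding I by (simp add: mult.assoc)
      moreover define L where "L = [1, -1 :: int]"
      moreover have "s \<in> set L" "x 1 \<in> set L" "x 2 \<in> set L" "x 3 \<in> set L" "x 4 \<in> set L" "x 5 \<in> set L"
        using s x' by (auto simp: L_def)
      ultimately show "v \<in> set spinor_roots"
        unfolding spinor_roots_def v L_def[symmetric] by auto blast
    qed
    show ?thesis
    proof (intro equalityI subsetI)
      fix v assume "v \<in> ?S"
      then obtain s :: real and \<nu> where
        v: "v = s *\<^sub>R ((1/2) *\<^sub>R (eb 8 - eb 7 - eb 6 + (\<Sum>i=1..5. (-1) ^ \<nu> i *\<^sub>R eb i)))"
        and s: "s \<in> {1, -1}" and \<nu>: "even (\<Sum>i=1..5. \<nu> i)" by blast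
      from s obtain s' :: int where "s = of_int s'" "s' \<in> {1, -1}"
        by (metis insertE insertI1 insertI2 of_int_1 of_int_minus singletonD)
      \<comment> \<open>Exponents become signs, and the product of the signs is -1 raised to the sum
        of the exponents.\<close>
      moreover define x :: "nat \<Rightarrow> int" where "x i = (-1) ^ \<nu> i" for i
      have "(\<Prod>i=1..5. x i) = 1"
        using \<nu> unfolding x_def power_sum[symmetric] by (rule neg_one_even_power)
      moreover have "x i \<in> {1, -1}" for i
        by (simp add: x_def minus_one_power_iff)
      ultimately have "[s' * x 1, s' * x 2, s' * x 3, s' * x 4, s' * x 5, - s', - s', s'] \<in> set spinor_roots"
        unfolding set by blast
      moreover have "v = doubled [s' * x 1, s' * x 2, s' * x 3, s' * x 4, s' * x 5, - s', - s', s']"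
        unfolding v doubled_spinor \<open>s = of_int s'\<close> by (simp add: x_def)
      ultimately show "v \<in> doubled ` set spinor_roots" by blast
    next
      fix v assume "v \<in> doubled ` set spinor_roots"
      then obtain u where "u \<in> set spinor_roots" "v = doubled u" by blast
      then obtain s and x :: "nat \<Rightarrow> int"
        where v: "v = doubled [s * x 1, s * x 2, s * x 3, s * x 4, s * x 5, - s, - s, s]"
        and s: "s \<in> {1, -1}" and x: "\<forall>i\<in>{1..5}. x i \<in> {1, -1}" "(\<Prod>i=1..5. x i) = 1"
        unfolding set by blast
      define \<nu> where "\<nu> i = (if x i = 1 then 0 else 1 :: nat)" for i
      have \<nu>: "x i = (-1) ^ \<nu> i" if "i \<in> {1..5}" for i
        using x(1) that by (auto simp: \<nu>_def)
      have "(-1) ^ (\<Sum>i=1..5. \<nu> i) = (1::int)"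
        using x(2) \<nu> by (simp add: power_sum)
      then have "even (\<Sum>i=1..5. \<nu> i)" by (simp add: minus_one_power_iff split: if_splits)
      moreover have "v = of_int s *\<^sub>R ((1/2) *\<^sub>R (eb 8 - eb 7 - eb 6 + (\<Sum>i=1..5. (-1) ^ \<nu> i *\<^sub>R eb i)))"
        unfolding v doubled_spinor by (simp add: \<nu>)
      ultimately show "v \<in> ?S"
        using s by (intro CollectI exI[of _ "of_int s"] exI[of _ \<nu>]) (auto simp: \<nu>_def)
    qed
  qed
  ultimately show ?thesis
    unfolding E6_def by (simp add: image_Un)
qed

declare comb.simps [simp del] lexpos.simps [simp del] eb_coords.simps [simp del]
  height.simps [simp del]

lemma E6_comb: "E6 = comb ` set (posroots @ map uminus posroots)"
proof -
  have "set (integral_roots @ spinor_roots) = eb_coords ` set (posroots @ map uminus posroots)"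
    using eb_coords_posroots eb_coords_surj unfolding list_all_iff set_map by blast
  then show ?thesis
    unfolding E6_doubled comb_doubled[abs_def] by (simp only: image_image)
qed

section \<open>Squared lengths and inner products of roots\<close>

lemma doubled_norm: "doubled xs \<bullet> doubled xs = of_int (\<Sum>k<8. (xs ! k)\<^sup>2) / 4"
  by (simp add: doubled_def inner_sum_left inner_sum_right eb_inner if_distrib
      power2_eq_square cong: if_cong)
    (simp add: sum_distrib_left)

lemma E6_norm:
  assumes "r \<in> E6"
  shows "r \<bullet> r = 2"
proof -
  obtain xs where xs: "r = doubled xs" "xs \<in> set (integral_roots @ spinor_roots)"
    using assms unfolding E6_doubled by blast
  have "(\<Sum>k\<leftarrow>[0..<8]. (xs ! k)\<^sup>2) = 8"
    using eb_coords_norm xs(2) unfolding list_all_iff by blast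
  then have "(\<Sum>k<8. (xs ! k)\<^sup>2) = 8"
    by (simp add: interv_sum_list_conv_sum_set_nat atLeast0LessThan)
  then show ?thesis
    by (simp only: xs doubled_norm)
qed

lemma E6_uminus: "r \<in> E6 \<Longrightarrow> - r \<in> E6"
proof -
  assume "r \<in> E6"
  then obtain x where "r = comb x" "x \<in> set posroots \<or> - x \<in> set posroots"
    by (auto simp: E6_comb)
  then have "- r = comb (- x)" "- x \<in> set (posroots @ map uminus posroots)"
    by (auto simp: comb_minus intro: image_eqI[of x uminus "- x"] image_eqI[of "-x" uminus "x"])
  then show "- r \<in> E6"
    unfolding E6_comb by blast
qed

lemma E6_uminus_iff [simp]: "- r \<in> E6 \<longleftrightarrow> r \<in> E6"
  using E6_uminus[of r] E6_uminus[of "- r"] by auto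

lemma zero_notin_E6 [simp]: "0 \<notin> E6"
  using E6_norm[of 0] by auto

text \<open>Expanding the squared length of \<open>r + s\<close> gives 2 = 2 + 2 + 2 (r, s).\<close>

lemma E6_inner:
  assumes "r \<in> E6" "s \<in> E6" "r + s \<in> E6"
  shows "r \<bullet> s = -1"
  using E6_norm[OF assms(1)] E6_norm[OF assms(2)] E6_norm[OF assms(3)]
  by (simp add: inner_add_left inner_add_right inner_commute)

lemma E6_diff:
  assumes "r \<in> E6" "s \<in> E6" "r + s \<in> E6"
  shows "r - s \<notin> E6" "r \<noteq> s"
proof -
  have "(r - s) \<bullet> (r - s) = 6"
    using E6_norm[OF assms(1)] E6_norm[OF assms(2)] E6_inner[OF assms]
    by (simp add: inner_diff_left inner_diff_right inner_commute)
  then show "r - s \<notin> E6" "r \<noteq> s"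
    using E6_norm[of "r - s"] by auto
qed

text \<open>Both (r, s) and (s, t) are -1, so the squared length 2 of \<open>r + s + t\<close>
  forces (r, t) = 0. Then \<open>r + t\<close> has squared length 4, which is neither 2 nor
  0.\<close>

lemma E6_outer:
  assumes "r \<in> E6" "s \<in> E6" "t \<in> E6" "r + s \<in> E6" "s + t \<in> E6" "r + s + t \<in> E6"
  shows "r + t \<notin> E6" "r + t \<noteq> 0"
proof -
  have "(r + t) \<bullet> (r + t) = 4"
    using assms[THEN E6_norm] E6_inner[of r s] E6_inner[of s t] assms
    by (simp add: inner_add_left inner_add_right inner_commute)
  then show "r + t \<notin> E6" "r + t \<noteq> 0"
    using E6_norm[of "r + t"] by auto
qed

section \<open>Special and extraspecial pairs\<close>

lemma comb_in_E6: "x \<in> set posroots \<Longrightarrow> comb x \<in> E6"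
  by (simp add: E6_comb)

lemma positive_root_iff: "r \<in> E6 \<and> 0 \<prec> r \<longleftrightarrow> r \<in> comb ` set posroots"
proof -
  have "\<not> lexpos (- x)" if "x \<in> set posroots" for x
    using lexpos_posroots that lexpos_add[of x "- x"] lexpos_0 by (auto simp: list_all_iff)
  then show ?thesis
    using lexpos_posroots unfolding E6_comb by (auto simp: zero_prec_comb list_all_iff)
qed

lemma special_comb_iff:
  "special (comb x) (comb y) \<longleftrightarrow>
     x \<in> set posroots \<and> y \<in> set posroots \<and> x + y \<in> set posroots \<and> lexpos (y - x)"
proof -
  have pos: "comb u \<in> E6 \<and> 0 \<prec> comb u \<longleftrightarrow> u \<in> set posroots" for u
    unfolding positive_root_iff using inj_comb by (simp add: inj_image_mem_iff)
  have 1: "0 \<prec> comb y" if "0 \<prec> comb x" "comb x \<prec> comb y"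
    using that lexpos_add[of x "y - x"] by (simp add: prec_comb zero_prec_comb)
  have 2: "0 \<prec> comb x + comb y" if "0 \<prec> comb x" "0 \<prec> comb y"
    using that lexpos_add[of x y] by (simp add: zero_prec_comb flip: comb_add)
  show ?thesis
    using 1 2 pos[of x] pos[of y] pos[of "x + y"] by (auto simp: special_def prec_comb comb_add)
qed

lemma specialE:
  assumes "special r s"
  obtains x y where "r = comb x" "s = comb y" "x \<in> set posroots" "y \<in> set posroots"
    "x + y \<in> set posroots" "lexpos (y - x)"
proof -
  have "r \<in> E6" "s \<in> E6" using assms by (auto simp: special_def)
  then obtain x y where "r = comb x" "s = comb y" by (auto simp: E6_comb)
  with assms special_comb_iff that show ?thesis by blast
qed

lemma first_summand_extraspecial:
  assumes g: "g \<in> set posroots" and z: "first_summand g = Some z"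
  shows "z \<in> set posroots" "g - z \<in> set posroots" "extraspecial (comb z) (comb (g - z))"
proof -
  obtain i where i: "i < length posroots" "posroots ! i = z" "g - z \<in> set posroots"
    and least: "\<And>j. j < i \<Longrightarrow> g - posroots ! j \<notin> set posroots"
    using z unfolding first_summand_def find_Some_iff by blast
  show z': "z \<in> set posroots" and gz: "g - z \<in> set posroots"
    using i by auto
  \<comment> \<open>Minimality is stated for every positive summand of \<open>g\<close>, whether or
    not it is the smaller one of its pair.\<close>
  have min: "z = u \<or> lexpos (u - z)" if "u \<in> set posroots" "g - u \<in> set posroots" for u
  proof -
    obtain j where j: "j < length posroots" "posroots ! j = u"
      using \<open>u \<in> set posroots\<close> by (auto simp: in_set_conv_nth)
    with least that have "i \<le> j" by (metis linorder_not_le)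
    then show ?thesis
      using sorted_posroots i j by (auto simp: sorted_wrt_iff_nth_less le_less)
  qed
  have "z \<noteq> g - z"
    using E6_diff(2)[of "comb z" "comb (g - z)"] z' gz g by (auto simp: comb_in_E6 simp flip: comb_add)
  \<comment> \<open>The complement \<open>g - z\<close> is itself a summand of \<open>g\<close>, so
    minimality applies to it and gives the order required of a special pair.\<close>
  then have "lexpos (g - z - z)"
    using min[OF gz] z' by auto
  then have "special (comb z) (comb (g - z))"
    using z' gz g by (simp add: special_comb_iff)
  moreover have "comb z = r \<or> comb z \<prec> r"
    if "special r s" "r + s = comb z + comb (g - z)" for r s
  proof -
    obtain u v where uv: "r = comb u" "s = comb v" "u \<in> set posroots" "v \<in> set posroots"
      using \<open>special r s\<close> by (rule specialE)
    with that have "comb (u + v) = comb g" by (simp add: comb_add comb_diff)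
    then have "v = g - u" using inj_comb by (auto dest: injD)
    with uv min[of u] have "z = u \<or> lexpos (u - z)" by simp
    then show ?thesis unfolding uv prec_comb by blast
  qed
  ultimately show "extraspecial (comb z) (comb (g - z))"
    unfolding extraspecial_def by blast
qed

section \<open>The table of signs and the reach of the symmetries\<close>

lemma negative_pairs_comb: "negative_pairs = map_prod comb comb ` set neg_pairs"
  unfolding negative_pairs_def neg_pairs_def
  by (simp add: comb.simps add_ac)

lemma inj_comb_pair: "inj (map_prod comb comb)"
  by (intro prod.inj_map inj_comb)

lemma card_negative_pairs: "card negative_pairs = 34"
  unfolding negative_pairs_comb
  using distinct_neg_pairs by (simp add: card_image inj_on_subset[OF inj_comb_pair] distinct_card)

lemma negative_pairs_iff: "(comb x, comb y) \<in> negative_pairs \<longleftrightarrow> (x, y) \<in> set neg_pairs"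
  using inj_image_mem_iff[OF inj_comb_pair, of "(x, y)"] by (simp add: negative_pairs_comb)

text \<open>If both roots have the same sign, the pair is special up to swapping and negation.
  Otherwise a signed relation among \<open>r\<close>, \<open>s\<close> and \<open>r + s\<close>
  writes one of them as a sum of two positive roots, and the pair arises from that sum.\<close>

lemma E6_pair_obtained:
  assumes "r \<in> E6" "s \<in> E6" "r + s \<in> E6"
  shows "(r, s) \<in> obtained_pairs"
proof -
  have pm: "0 \<prec> u \<or> 0 \<prec> - u" if "u \<in> E6" for u :: "real^8"
    using that lexpos_posroots by (auto simp: E6_comb zero_prec_comb comb_minus[symmetric] list_all_iff)
  have special: "special u v \<or> special v u"
    if "u \<in> E6" "v \<in> E6" "u + v \<in> E6" "0 \<prec> u" "0 \<prec> v" for u v :: "real^8"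
  proof -
    obtain x y where xy: "u = comb x" "v = comb y" using \<open>u \<in> E6\<close> \<open>v \<in> E6\<close> by (auto simp: E6_comb)
    have "x \<noteq> y" using E6_diff(2)[OF that(1-3)] xy by auto
    with lexpos_cases[of "y - x"] have "u \<prec> v \<or> v \<prec> u"
      by (auto simp: xy prec_comb)
    with that show ?thesis by (auto simp: special_def add.commute)
  qed
  note ob = obtained_pairs.intros
  have both: "(u, v) \<in> obtained_pairs \<and> (u, - (u + v)) \<in> obtained_pairs"
    if "u \<in> E6" "v \<in> E6" "u + v \<in> E6" "0 \<prec> u" "0 \<prec> v" for u v :: "real^8"
    using special[OF that] ob by (metis add.commute)
  have mixed: "(u, v) \<in> obtained_pairs"
    if "u \<in> E6" "v \<in> E6" "u + v \<in> E6" "0 \<prec> u" "0 \<prec> - v" for u v :: "real^8"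
  proof (cases "0 \<prec> u + v")
    case True
    \<comment> \<open>Here \<open>u\<close> is the sum of the positive roots \<open>- v\<close> and
      \<open>u + v\<close>. This gives the pair of \<open>- v\<close> and \<open>- u\<close>, which
      is then swapped and negated.\<close>
    have "(- v, - (- v + (u + v))) \<in> obtained_pairs"
      using both[of "- v" "u + v"] that True by simp
    from ob(5)[OF ob(4)[OF this]] show ?thesis by simp
  next
    case False
    with pm that have "0 \<prec> - (u + v)" by blast
    \<comment> \<open>Here \<open>- v\<close> is the sum of the positive roots \<open>u\<close> and
      \<open>- (u + v)\<close>.\<close>
    then have "(u, - (u + - (u + v))) \<in> obtained_pairs"
      using both[of u "- (u + v)"] that E6_uminus[of "u + v"] by simp
    then show ?thesis by simp
  qed
  consider "0 \<prec> r" "0 \<prec> s" | "0 \<prec> r" "0 \<prec> - s" | "0 \<prec> - r" "0 \<prec> s" | "0 \<prec> - r" "0 \<prec> - s"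
    using pm assms by blast
  then show ?thesis
  proof cases
    case 1 then show ?thesis using both assms by blast
  next
    case 2 then show ?thesis using mixed assms by blast
  next
    case 3 then show ?thesis using mixed[of s r] assms ob(4) by (simp add: add.commute)
  next
    case 4
    then have "(- r, - s) \<in> obtained_pairs"
      using both[of "- r" "- s"] assms E6_uminus[of "r + s"] by simp
    from ob(5)[OF this] show ?thesis by simp
  qed
qed

section \<open>Identities between structure constants\<close>

context lie_algebra
begin

lemma bracket_zero [simp]: "\<lbrakk>x, 0\<rbrakk> = 0" "\<lbrakk>0, x\<rbrakk> = 0"
  using bracket_add_right[of x 0 0] bracket_add_left[of 0 0 x] by simp_all

lemma bracket_swap: "\<lbrakk>y, x\<rbrakk> = - \<lbrakk>x, y\<rbrakk>"
proof -
  have "\<lbrakk>x + y, x + y\<rbrakk> = \<lbrakk>x, y\<rbrakk> + \<lbrakk>y, x\<rbrakk>"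
    unfolding bracket_add_left bracket_add_right by (simp add: bracket_self)
  then show ?thesis by (simp add: bracket_self eq_neg_iff_add_eq_0 add.commute)
qed

lemma bracket_minus_right: "\<lbrakk>x, - y\<rbrakk> = - \<lbrakk>x, y\<rbrakk>"
  using bracket_add_right[of x y "- y"] by (simp add: eq_neg_iff_add_eq_0 add.commute)

end

context E6_chevalley_basis
begin

lemma e_nonzero: "r \<in> E6 \<Longrightarrow> e r \<noteq> 0"
  using basis(1) dependent_zero by (metis UnI2 imageI)

lemma N_pm1: "r \<in> E6 \<Longrightarrow> s \<in> E6 \<Longrightarrow> r + s \<in> E6 \<Longrightarrow> N r s = 1 \<or> N r s = -1"
  using N_root by blast

lemma bracket_e:
  assumes "r \<in> E6" "s \<in> E6" "r + s \<in> E6"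
  shows "\<lbrakk>e r, e s\<rbrakk> = N r s *C e (r + s)"
  using assms bracket_roots by (metis zero_notin_E6)

lemma N_swap:
  assumes "r \<in> E6" "s \<in> E6" "r + s \<in> E6"
  shows "N s r = - N r s"
proof -
  have "N s r *C e (r + s) = (- N r s) *C e (r + s)"
    using bracket_e[OF assms] bracket_e[of s r] assms bracket_swap[of "e s" "e r"]
    by (simp add: add.commute)
  then show ?thesis
    using e_nonzero[OF assms(3)] scale_right_imp_eq by blast
qed

text \<open>As all roots have squared length 2, the Cartan integer is just the inner
  product.\<close>

lemma bracket_h_e:
  assumes "r \<in> E6" "s \<in> E6"
  shows "\<lbrakk>h r, e s\<rbrakk> = of_real (s \<bullet> r) *C e s"
proof -
  have "h r \<in> H" using coroot[OF assms(1)] by (simp add: is_coroot_def)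
  then have "\<lbrakk>h r, e s\<rbrakk> = \<phi> s (h r) *C e s"
    using root_vector[OF assms(2)] by (simp add: root_space_def)
  also have "\<phi> s (h r) = of_real (2 * (s \<bullet> r) / (r \<bullet> r))"
    using type_E6 coroot[OF assms(1)] assms unfolding E6_root_iso_def by blast
  finally show ?thesis by (simp add: E6_norm assms)
qed

text \<open>The Jacobi identity gives a linear relation among three coroots. They act on
  \<open>e r\<close> by 2, -1, -1, which leaves a relation among three signs.\<close>

lemma N_cyclic:
  assumes "r \<in> E6" "s \<in> E6" "t \<in> E6" "r + s + t = 0"
  shows "N r s = N s t"
proof -
  have rst: "r = - (s + t)" "s = - (t + r)" "t = - (r + s)"
    using assms(4) by (simp_all only: eq_neg_iff_add_eq_0 add_ac)
  have sums: "s + t \<in> E6" "t + r \<in> E6" "r + s \<in> E6"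
    using assms(1-3) E6_uminus rst by (metis add.inverse_inverse)+
  have "\<lbrakk>e r, \<lbrakk>e s, e t\<rbrakk>\<rbrakk> = N s t *C h r"
    using bracket_e[of s t] assms sums rst(1) bracket_opposite[of r] bracket_scale_right
    by (metis add.inverse_inverse)
  moreover have "\<lbrakk>e s, \<lbrakk>e t, e r\<rbrakk>\<rbrakk> = N t r *C h s"
    using bracket_e[of t r] assms sums rst(2) bracket_opposite[of s] bracket_scale_right
    by (metis add.inverse_inverse)
  moreover have "\<lbrakk>e t, \<lbrakk>e r, e s\<rbrakk>\<rbrakk> = N r s *C h t"
    using bracket_e[of r s] assms sums rst(3) bracket_opposite[of t] bracket_scale_right
    by (metis add.inverse_inverse)
  ultimately have "N s t *C h r + N t r *C h s + N r s *C h t = 0"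
    using jacobi[of "e r" "e s" "e t"] by simp
  then have "\<lbrakk>N s t *C h r + N t r *C h s + N r s *C h t, e r\<rbrakk> = 0"
    by simp
  then have "(2 * N s t - N t r - N r s) *C e r = 0"
    using assms(1-3) sums E6_inner[of r s] E6_inner[of t r]
    by (simp add: bracket_add_left bracket_scale_left bracket_h_e E6_norm inner_commute
        scale_left_distrib scale_left_diff_distrib mult.commute)
  then have "2 * N s t - N t r - N r s = 0"
    using e_nonzero[OF assms(1)] by simp
  then have "2 * N s t = N t r + N r s"
    by (simp add: algebra_simps)
  \<comment> \<open>The left side is 2 or -2, so the two signs on the right must both equal
    \<open>N s t\<close>.\<close>
  then show ?thesis
    using N_pm1[of s t] N_pm1[of t r] N_pm1[of r s] assms(1-3) sums by auto
qed

text \<open>By \<open>E6_outer\<close> the bracket of \<open>e t\<close> and \<open>e r\<close>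
  vanishes, so only two terms of the Jacobi identity survive.\<close>

lemma N_cocycle:
  assumes "r \<in> E6" "s \<in> E6" "t \<in> E6" "r + s \<in> E6" "s + t \<in> E6" "r + s + t \<in> E6"
  shows "N r s * N (r + s) t = N s t * N r (s + t)"
proof -
  have "\<lbrakk>e t, e r\<rbrakk> = 0"
    using E6_outer[OF assms] assms bracket_roots[of t r] N_nonroot[of t r]
    by (simp add: add.commute)
  moreover have "\<lbrakk>e r, \<lbrakk>e s, e t\<rbrakk>\<rbrakk> = (N s t * N r (s + t)) *C e (r + s + t)"
    using assms by (simp add: bracket_e bracket_scale_right add.assoc)
  moreover have "\<lbrakk>e t, \<lbrakk>e r, e s\<rbrakk>\<rbrakk> = - ((N r s * N (r + s) t) *C e (r + s + t))"
    using assms bracket_swap[of "e t" "e (r + s)"]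
    by (simp add: bracket_e bracket_scale_right)
  ultimately have "(N s t * N r (s + t) - N r s * N (r + s) t) *C e (r + s + t) = 0"
    using jacobi[of "e r" "e s" "e t"] by (simp add: scale_left_diff_distrib)
  then show ?thesis
    using e_nonzero[OF assms(6)] by simp
qed

text \<open>The roots \<open>r\<close>, \<open>s\<close>, \<open>- (r + s)\<close> sum to 0; cyclic
  invariance is applied with \<open>r\<close>, \<open>s\<close> in either order.\<close>

lemma N_minus_sum:
  assumes "r \<in> E6" "s \<in> E6" "r + s \<in> E6"
  shows "N r (- (r + s)) = - N r s" "N s (- (r + s)) = N r s"
proof -
  have "- (r + s) \<in> E6" using assms E6_uminus by blast
  then show "N s (- (r + s)) = N r s"
    using N_cyclic[of r s "- (r + s)"] assms by simp
  show "N r (- (r + s)) = - N r s"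
    using N_cyclic[of s r "- (r + s)"] \<open>- (r + s) \<in> E6\<close> assms N_swap[OF assms] by simp
qed

text \<open>As \<open>s - r\<close> is not a root, the Jacobi identity for \<open>r\<close>,
  \<open>s\<close>, \<open>- r\<close> says that the product of the signs \<open>N r s\<close> and
  \<open>N (- r) (r + s)\<close> is 1, so they agree. Cyclic invariance for \<open>- s\<close>,
  \<open>- r\<close>, \<open>r + s\<close> then moves the second sign to the negated pair.\<close>

lemma N_uminus:
  assumes "r \<in> E6" "s \<in> E6" "r + s \<in> E6"
  shows "N (- r) (- s) = - N r s"
proof -
  have neg: "- r \<in> E6" "- s \<in> E6" using assms by simp_all
  have "\<lbrakk>e s, e (- r)\<rbrakk> = 0"
    using E6_diff[of s r] assms neg bracket_roots[of s "- r"] N_nonroot[of s "- r"]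
    by (simp add: add.commute)
  moreover have "\<lbrakk>e s, \<lbrakk>e (- r), e r\<rbrakk>\<rbrakk> = \<lbrakk>h r, e s\<rbrakk>"
    using bracket_opposite[OF assms(1)] bracket_swap[of "e (- r)" "e r"] bracket_swap[of "e s" "h r"]
    by (simp add: bracket_minus_right)
  moreover have "\<lbrakk>h r, e s\<rbrakk> = - e s"
    using bracket_h_e[of r s] E6_inner[OF assms] assms by (simp add: inner_commute)
  moreover have "\<lbrakk>e (- r), \<lbrakk>e r, e s\<rbrakk>\<rbrakk> = (N r s * N (- r) (r + s)) *C e s"
    using assms neg bracket_e[of "- r" "r + s"] by (simp add: bracket_e bracket_scale_right)
  ultimately have "(N r s * N (- r) (r + s) - 1) *C e s = 0"
    using jacobi[of "e r" "e s" "e (- r)"] by (simp add: scale_left_diff_distrib)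
  then have "N r s * N (- r) (r + s) = 1"
    using e_nonzero[OF assms(2)] by simp
  then have "N (- r) (r + s) = N r s"
    using N_pm1[OF assms] by (auto simp: minus_equation_iff)
  moreover have "N (- r) (r + s) = N (- s) (- r)"
    using N_cyclic[of "- s" "- r" "r + s"] neg assms by simp
  moreover have "N (- s) (- r) = - N (- r) (- s)"
    using N_swap[of "- r" "- s"] neg assms E6_uminus[of "r + s"] by simp
  ultimately show ?thesis by (metis add.inverse_inverse)
qed

end

section \<open>The values\<close>

lemma height_add: "height (x + y) = height x + height y"
  by (cases x; cases y) (simp add: height.simps)

lemma sgn_coords_swap: "x \<noteq> y \<Longrightarrow> sgn_coords y x = - sgn_coords x y"
  using lexpos_cases[of "y - x"] lexpos_add[of "x - y" "y - x"] lexpos_0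
  by (auto simp: sgn_coords_def)

lemma (in E6_chevalley_basis) N_sgn_coords:
  assumes pos: "\<And>r s. extraspecial r s \<Longrightarrow> N r s = 1"
    and "x \<in> set posroots" "y \<in> set posroots" "x + y \<in> set posroots"
  shows "N (comb x) (comb y) = of_int (sgn_coords x y)"
  using assms(2-)
proof (induction "nat (height (x + y))" arbitrary: x y rule: less_induct)
  case less
  have E6: "comb u \<in> E6" if "u \<in> set posroots" for u
    using that by (rule comb_in_E6)
  \<comment> \<open>The omitted positive root \<open>w\<close> has positive height, so the sum
    \<open>u + v\<close> is strictly lower than \<open>x + y\<close>.\<close>
  have IH: "N (comb u) (comb v) = of_int (sgn_coords u v)"
    if "u + v + w = x + y" "u \<in> set posroots" "v \<in> set posroots" "w \<in> set posroots"
      "u + v \<in> set posroots"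
    for u v w
  proof (rule less.hyps)
    have "0 < height w" "height (u + v) + height w = height (x + y)" "0 < height (u + v)"
      using that height_posroots by (auto simp: list_all_iff height_add simp flip: that(1))
    then show "nat (height (u + v)) < nat (height (x + y))" by linarith
  qed (use that in auto)
  \<comment> \<open>The sum is abstracted to \<open>g\<close> so that the claim can be used for
    \<open>(x, y)\<close> and for \<open>(y, x)\<close>.\<close>
  have ordered: "N (comb x) (comb y) = of_int (sgn_coords x y)"
    if xy: "x \<in> set posroots" "y \<in> set posroots" "lexpos (y - x)"
      and sum: "x + y = g" and g: "g \<in> set posroots"
      and IH: "\<And>u v w. u + v + w = g \<Longrightarrow> u \<in> set posroots \<Longrightarrow> v \<in> set posroots \<Longrightarrow>
        w \<in> set posroots \<Longrightarrow> u + v \<in> set posroots \<Longrightarrow> N (comb u) (comb v) = of_int (sgn_coords u v)"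
    for x y g
  proof -
    have "check_pair x y"
      using check_pairs xy by (auto simp: list_all_iff)
    then obtain z where z: "first_summand g = Some z" and cases:
      "if x = z then sgn_coords x y = 1
       else if x - z \<in> set posroots then sgn_coords x y = sgn_coords (x - z) y * sgn_coords z (x - z)
       else y - z \<in> set posroots \<and> sgn_coords x y = - sgn_coords (y - z) x * sgn_coords z (y - z)"
      using xy sum g by (auto simp: check_pair_def split: option.splits if_splits)
    note zs = first_summand_extraspecial[OF g z]
    have Nz: "N (comb z) (comb (g - z)) = 1"
      by (rule pos) (rule zs)
    \<comment> \<open>The cocycle identity for \<open>z\<close>, \<open>u - z\<close>,
      \<open>v\<close>, in which the extraspecial pair \<open>(z, g - z)\<close> contributes 1. The
      variable \<open>u\<close> stands for either root of the pair.\<close>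
    have step: "N (comb u) (comb v) = of_int (sgn_coords (u - z) v * sgn_coords z (u - z))"
      if "u \<in> set posroots" "v \<in> set posroots" "u - z \<in> set posroots" "u + v = g" for u v
    proof -
      have gz: "z + (u - z) = u" "u - z + v = g - z" "z + (g - z) = g"
        using \<open>u + v = g\<close> by (simp_all add: algebra_simps)
      have E6s: "comb z \<in> E6" "comb (u - z) \<in> E6" "comb v \<in> E6"
        "comb z + comb (u - z) \<in> E6" "comb (u - z) + comb v \<in> E6"
        "comb z + comb (u - z) + comb v \<in> E6"
        unfolding comb_add[symmetric] gz using that zs g by (auto intro!: E6)
      from N_cocycle[OF this]
      have "N (comb z) (comb (u - z)) * N (comb (z + (u - z))) (comb v) =
          N (comb (u - z)) (comb v) * N (comb z) (comb (u - z + v))"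
        unfolding comb_add .
      then have "N (comb z) (comb (u - z)) * N (comb u) (comb v) = N (comb (u - z)) (comb v)"
        using Nz gz by simp
      moreover have "N (comb z) (comb (u - z)) = of_int (sgn_coords z (u - z))"
        by (rule IH[of _ _ v]) (use that zs in auto)
      moreover have "N (comb (u - z)) (comb v) = of_int (sgn_coords (u - z) v)"
        by (rule IH[of _ _ z]) (use that zs in \<open>simp_all add: gz\<close>)
      moreover have "sgn_coords z (u - z) = 1 \<or> sgn_coords z (u - z) = -1"
        by (simp add: sgn_coords_def)
      \<comment> \<open>A sign is its own inverse, so the factor for \<open>(z, u - z)\<close> can
        be moved to the other side.\<close>
      ultimately show ?thesis
        by (elim disjE) (simp_all add: minus_equation_iff[of "N (comb u) (comb v)"])
    qed
    \<comment> \<open>When \<open>z\<close> is subtracted from \<open>y\<close>, \<open>step\<close>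
      computes the constant of the swapped pair; this accounts for the minus sign in
      \<open>check_pair\<close>.\<close>
    have "N (comb x) (comb y) = - N (comb y) (comb x)"
      by (rule N_swap) (use E6 xy sum g in \<open>auto simp: add.commute simp flip: comb_add\<close>)
    moreover have "N (comb x) (comb y) = 1" if "x = z"
      using Nz that sum[symmetric] by simp
    ultimately show ?thesis
      using cases step[of x y] step[of y x] xy sum
      by (simp add: add.commute split: if_splits)
  qed
  have "x \<noteq> y"
    using E6_diff(2)[of "comb x" "comb y"] E6 less.prems by (auto simp flip: comb_add)
  then consider "lexpos (y - x)" | "lexpos (x - y)"
    using lexpos_cases[of "y - x"] by auto
  then show ?case
  proof cases
    case 1
    then show ?thesis using ordered[of x y] less.prems IH by blast
  next
    case 2
    then have "N (comb y) (comb x) = of_int (sgn_coords y x)"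
      using ordered[of y x "x + y"] less.prems IH by (simp add: add.commute)
    moreover have "N (comb x) (comb y) = - N (comb y) (comb x)"
      by (rule N_swap) (use E6 less.prems in \<open>auto simp: add.commute simp flip: comb_add\<close>)
    ultimately show ?thesis
      using sgn_coords_swap[OF \<open>x \<noteq> y\<close>] by simp
  qed
qed

theorem theorem2:
  fixes scale :: "complex \<Rightarrow> 'g::ab_group_add \<Rightarrow> 'g"
    and bracket :: "'g \<Rightarrow> 'g \<Rightarrow> 'g"
    and H :: "'g set"
    and \<phi> :: "real^8 \<Rightarrow> 'g \<Rightarrow> complex"
    and h e :: "real^8 \<Rightarrow> 'g"
    and N :: "real^8 \<Rightarrow> real^8 \<Rightarrow> complex"
  assumes chevalley: "E6_chevalley_basis scale bracket H \<phi> h e N"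
    and extraspecial_pos: "\<And>r s. extraspecial r s \<Longrightarrow> N r s = 1"
  shows "card negative_pairs = 34 \<and>
    (\<forall>r s. special r s \<longrightarrow> N r s = (if (r, s) \<in> negative_pairs then -1 else 1)) \<and>
    (\<forall>p q. special p q \<longrightarrow> N p (- (p + q)) = - N p q \<and> N q (- (p + q)) = N p q) \<and>
    (\<forall>r\<in>E6. \<forall>s\<in>E6. r + s \<in> E6 \<longrightarrow>
       N s r = - N r s \<and> N (- r) (- s) = - N r s \<and> (r, s) \<in> obtained_pairs)"
proof -
  interpret E6_chevalley_basis scale bracket H \<phi> h e N by (fact chevalley)
  have "N r s = (if (r, s) \<in> negative_pairs then -1 else 1)" if "special r s" for r s
  proof -
    obtain x y where "r = comb x" "s = comb y" and xy: "x \<in> set posroots" "y \<in> set posroots"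
      "x + y \<in> set posroots" "lexpos (y - x)"
      using \<open>special r s\<close> by (rule specialE)
    with N_sgn_coords[OF extraspecial_pos xy(1-3)] show ?thesis
      by (simp add: sgn_coords_def negative_pairs_iff)
  qed
  moreover have "N p (- (p + q)) = - N p q \<and> N q (- (p + q)) = N p q" if "special p q" for p q
    using that N_minus_sum[of p q] by (auto simp: special_def)
  ultimately show ?thesis
    using card_negative_pairs N_swap N_uminus E6_pair_obtained by blast
qed

end
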